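(* Let $m,n$ be relatively prime positive integers. Then $$\sum_{\mathfrak{p}\in\mathcal{PT}_m^n} q^{\mathsf{area}(\mathfrak{p})}=\sum_{\mathfrak{p}\in\mathcal{PT}_m^n} q^{\mathsf{dinv}(\mathfrak{p})},$$ i.e. the statistics $\mathsf{area}$ and $\mathsf{dinv}$ are equidistributed on $(m,n)$-parking words (identified with $\mathcal{PT}_m^n$ via the bijection $A$ below).
   Context: Fix coprime positive integers $m,n$. The level of $(i,j)\in\mathbb{Z}^2$ is $\ell(i,j)=im+jn$. Order $\mathbb{Z}^2$ componentwise. An $(m,n)$-filter is a nonempty proper subset $\mathfrak{i}\subsetneq\mathbb{Z}^2$ which is upward closed (an order filter) and such that whenever $(i,j)\in\mathfrak{i}$, every point of $\mathbb{Z}^2$ with the same level $\ell(i,j)$ lies in $\mathfrak{i}$. Let $m(\mathfrak{i})$ be the set of the numbers $\min\{\ell(i,j):(i,j)\in\mathfrak{i}\}$ for $j\in\mathbb{Z}$ (minimum taken over $i$ with $j$ fixed); it consists of $m$ integers, one in each residue class mod $m$. An $(m,n)$-filter is Dyck if the minimum level of its points is $0$. An $(m,n)$-filter tuple is a tuple of $(m,n)$-filters $(\mathfrak{p}^{(0)},\ldots,\mathfrak{p}^{(n)})$ together with integers $p_0,\ldots,p_{n-1}$ such that $p_i\in m(\mathfrak{p}^{(i)})$ and $m(\mathfrak{p}^{(i+1)})=(m(\mathfrak{p}^{(i)})\setminus\{p_i\})\cup\{p_i+m\}$ for $0\le i<n$, and $m(\mathfrak{p}^{(n)})=\{x+n:x\in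 m(\mathfrak{p}^{(0)})\}$; write $n(\mathfrak{p})=[p_0,\ldots,p_{n-1}]$. It is parking if $\mathfrak{p}^{(0)}$ is Dyck; $\mathcal{PT}_m^n$ denotes the set of parking $(m,n)$-filter tuples. Let $a$ be an integer with $an\equiv-1\pmod m$. Define $A(\mathfrak{p})\in[m]^n$ by $A(\mathfrak{p})_i=$ the residue of $a p_i$ modulo $m$ in $\{0,\ldots,m-1\}$ (this is a bijection from $\mathcal{PT}_m^n$ to the set of $(m,n)$-parking words $\mathcal{PW}_m^n=\{{\sf p}\in[m]^n: |\{j:{\sf p}_j<i\}|\ge in/m \text{ for } 1\le i\le m\}$). Define $B(\mathfrak{p})\in[m]^n$ by $B(\mathfrak{p})_i=|\{x\in m(\mathfrak{p}^{(i)}):x<p_i\}|$ for $0\le i<n$. Finally $\mathsf{area}(\mathfrak{p})=\frac{(n-1)(m-1)}{2}-\sum_{i}A(\mathfrak{p})_i$ and $\mathsf{dinv}(\mathfrak{p})=\frac{(n-1)(m-1)}{2}-\sum_i B(\mathfrak{p})_i$. *)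

theory Defs
  imports
    "HOL-Number_Theory.Cong"
    "HOL-Computational_Algebra.Formal_Laurent_Series"
begin

definition level :: "nat \<Rightarrow> nat \<Rightarrow> int \<times> int \<Rightarrow> int" where
  "level m n = (\<lambda>(i, j). i * int m + j * int n)"

definition mn_filter :: "nat \<Rightarrow> nat \<Rightarrow> (int \<times> int) set \<Rightarrow> bool" where
  "mn_filter m n F \<longleftrightarrow>
     F \<noteq> {} \<and> F \<noteq> UNIV \<and>
     (\<forall>i j i' j'. (i, j) \<in> F \<and> i \<le> i' \<and> j \<le> j' \<longrightarrow> (i', j') \<in> F) \<and>
     (\<forall>v w. v \<in> F \<and> level m n w = level m n v \<longrightarrow> w \<in> F)"

text \<open>The set \<open>m(F)\<close>: the minimal level of each row, a row being the points of \<open>F\<close> with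
  fixed second coordinate. The minimum is expressed as an attained lower bound; it exists in
  every row of a filter, see \<open>row_min\<close>.\<close>

definition min_levels :: "nat \<Rightarrow> nat \<Rightarrow> (int \<times> int) set \<Rightarrow> int set" where
  "min_levels m n F =
     {x. \<exists>j. (\<exists>i. (i, j) \<in> F \<and> x = level m n (i, j)) \<and>
             (\<forall>i. (i, j) \<in> F \<longrightarrow> x \<le> level m n (i, j))}"

definition dyck_filter :: "nat \<Rightarrow> nat \<Rightarrow> (int \<times> int) set \<Rightarrow> bool" where
  "dyck_filter m n F \<longleftrightarrow>
     mn_filter m n F \<and> (\<exists>v\<in>F. level m n v = 0) \<and> (\<forall>v\<in>F. 0 \<le> level m n v)"

text \<open>A filter tuple is a pair of lists: the filters (indexed from \<open>0\<close> to \<open>n\<close>) and the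
  integers \<open>p\<^sub>i\<close> (indexed from \<open>0\<close> to \<open>n - 1\<close>).\<close>

type_synonym ftuple = "(int \<times> int) set list \<times> int list"

definition filter_tuple :: "nat \<Rightarrow> nat \<Rightarrow> ftuple \<Rightarrow> bool" where
  "filter_tuple m n = (\<lambda>(Fs, ps).
     length Fs = n + 1 \<and> length ps = n \<and>
     (\<forall>F\<in>set Fs. mn_filter m n F) \<and>
     (\<forall>i<n. ps ! i \<in> min_levels m n (Fs ! i) \<and>
            min_levels m n (Fs ! (i + 1)) =
              (min_levels m n (Fs ! i) - {ps ! i}) \<union> {ps ! i + int m}) \<and>
     min_levels m n (Fs ! n) = (\<lambda>x. x + int n) ` min_levels m n (Fs ! 0))"

definition parking_tuples :: "nat \<Rightarrow> nat \<Rightarrow> ftuple set" where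
  "parking_tuples m n = {(Fs, ps). filter_tuple m n (Fs, ps) \<and> dyck_filter m n (Fs ! 0)}"

text \<open>The word \<open>A\<close> depends on an integer \<open>a\<close> with \<open>a n \<equiv> -1 (mod m)\<close>, but only on its residue
  modulo \<open>m\<close>.\<close>

definition A_word :: "nat \<Rightarrow> int \<Rightarrow> ftuple \<Rightarrow> int list" where
  "A_word m a = (\<lambda>(Fs, ps). map (\<lambda>x. (a * x) mod int m) ps)"

definition B_word :: "nat \<Rightarrow> nat \<Rightarrow> ftuple \<Rightarrow> int list" where
  "B_word m n = (\<lambda>(Fs, ps).
     map (\<lambda>i. int (card {x \<in> min_levels m n (Fs ! i). x < ps ! i})) [0..<n])"

text \<open>For coprime \<open>m\<close> and \<open>n\<close> the product \<open>(n - 1) (m - 1)\<close> is even, so the divisions by \<open>2\<close>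
  are exact.\<close>

definition area :: "nat \<Rightarrow> nat \<Rightarrow> int \<Rightarrow> ftuple \<Rightarrow> int" where
  "area m n a p = (int n - 1) * (int m - 1) div 2 - sum_list (A_word m a p)"

definition dinv :: "nat \<Rightarrow> nat \<Rightarrow> ftuple \<Rightarrow> int" where
  "dinv m n p = (int n - 1) * (int m - 1) div 2 - sum_list (B_word m n p)"

lemma mn_filter_up:
  "\<lbrakk>mn_filter m n F; (i, j) \<in> F; i \<le> i'; j \<le> j'\<rbrakk> \<Longrightarrow> (i', j') \<in> F"
  unfolding mn_filter_def by blast

lemma mn_filter_level:
  "\<lbrakk>mn_filter m n F; v \<in> F; level m n w = level m n v\<rbrakk> \<Longrightarrow> w \<in> F"
  unfolding mn_filter_def by blast

lemma mn_filter_move: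
  assumes F: "mn_filter m n F" and m: "0 < m" and v: "(i, j) \<in> F"
  shows "(i - int n * ((j' - j) div int m), j') \<in> F"
proof -
  let ?t = "(j' - j) div int m"
  have "(i - int n * ?t, j + int m * ?t) \<in> F"
    by (rule mn_filter_level[OF F v]) (simp add: level_def algebra_simps)
  moreover have "j + int m * ?t \<le> j'"
  proof -
    have "int m * ?t + (j' - j) mod int m = j' - j" by simp
    moreover have "0 \<le> (j' - j) mod int m" using m by simp
    ultimately show ?thesis by linarith
  qed
  ultimately show ?thesis using mn_filter_up[OF F] by blast
qed

lemma row_min:
  assumes F: "mn_filter m n F" and m: "0 < m"
  obtains i where "(i, j) \<in> F" "\<And>i'. (i', j) \<in> F \<Longrightarrow> i \<le> i'"
proof -
  have "F \<noteq> {}" "F \<noteq> UNIV" using F unfolding mn_filter_def by blast+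
  then obtain i0 j0 i1 j1 where "(i0, j0) \<in> F" and out: "(i1, j1) \<notin> F"
    by (metis UNIV_eq_I ex_in_conv surj_pair)
  from mn_filter_move[OF F m this(1)] obtain k where k: "(k, j) \<in> F" by blast
  define b where "b = i1 + int n * ((j1 - j) div int m)"
  have b: "b \<le> i" if "(i, j) \<in> F" for i
  proof (rule ccontr)
    assume "\<not> b \<le> i"
    then have "i - int n * ((j1 - j) div int m) \<le> i1" by (simp add: b_def)
    from mn_filter_up[OF F mn_filter_move[OF F m that] this order_refl] out show False
      by blast
  qed
  obtain i where i: "(i, j) \<in> F" "\<forall>i'. (i', j) \<in> F \<longrightarrow> nat (i - b) \<le> nat (i' - b)"
    using ex_has_least_nat[of "\<lambda>i. (i, j) \<in> F" k "\<lambda>i. nat (i - b)"] k by blast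
  show thesis
  proof
    show "(i, j) \<in> F" by fact
    show "i \<le> i'" if "(i', j) \<in> F" for i' using i b[of i'] b[of i] that by fastforce
  qed
qed

lemma mem_filter_iff:
  assumes F: "mn_filter m n F" and m: "0 < m"
  shows "(i, j) \<in> F \<longleftrightarrow>
    (\<exists>x\<in>min_levels m n F. x \<le> level m n (i, j) \<and> int m dvd level m n (i, j) - x)"
proof
  assume ij: "(i, j) \<in> F"
  obtain k where k: "(k, j) \<in> F" "\<And>i'. (i', j) \<in> F \<Longrightarrow> k \<le> i'"
    using row_min[OF F m] by blast
  have "level m n (k, j) \<in> min_levels m n F"
    unfolding min_levels_def using k by (auto simp: level_def mult_right_mono)
  moreover have "level m n (k, j) \<le> level m n (i, j)"
    using k(2)[OF ij] by (simp add: level_def mult_right_mono)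
  moreover have "level m n (i, j) - level m n (k, j) = int m * (i - k)"
    by (simp add: level_def algebra_simps)
  ultimately show "\<exists>x\<in>min_levels m n F. x \<le> level m n (i, j) \<and> int m dvd level m n (i, j) - x"
    by (metis dvd_triv_left)
next
  assume "\<exists>x\<in>min_levels m n F. x \<le> level m n (i, j) \<and> int m dvd level m n (i, j) - x"
  then obtain i' j' k where v: "(i', j') \<in> F" and le: "level m n (i', j') \<le> level m n (i, j)"
    and k: "level m n (i, j) - level m n (i', j') = int m * k"
    unfolding min_levels_def dvd_def by blast
  have "0 \<le> int m * k" using le k by linarith
  then have "0 \<le> k" using m by (simp add: zero_le_mult_iff)
  then have "(i' + k, j') \<in> F" using mn_filter_up[OF F v] by simp
  then show "(i, j) \<in> F"
    by (rule mn_filter_level[OF F]) (use k in \<open>simp add: level_def algebra_simps\<close>)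
qed

lemma inj_on_min_levels:
  assumes "0 < m" shows "inj_on (min_levels m n) {F. mn_filter m n F}"
proof (rule inj_onI)
  fix F G assume "F \<in> {F. mn_filter m n F}" "G \<in> {F. mn_filter m n F}"
    and eq: "min_levels m n F = min_levels m n G"
  then have F: "mn_filter m n F" and G: "mn_filter m n G" by blast+
  have "(i, j) \<in> F \<longleftrightarrow> (i, j) \<in> G" for i j
    unfolding mem_filter_iff[OF F assms] mem_filter_iff[OF G assms] eq ..
  then show "F = G" by (simp add: set_eq_iff split_paired_all)
qed

lemma dyck_min_levels:
  assumes F: "dyck_filter m n F" and m: "0 < m"
  shows "min_levels m n F \<subseteq> {0..int m * int n}"
proof
  fix x assume "x \<in> min_levels m n F"
  then obtain i j where ij: "(i, j) \<in> F" "x = level m n (i, j)"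
    and le: "\<And>i'. (i', j) \<in> F \<Longrightarrow> x \<le> level m n (i', j)"
    unfolding min_levels_def by blast
  from F obtain i0 j0 where v: "(i0, j0) \<in> F" "level m n (i0, j0) = 0"
    and F': "mn_filter m n F" and ge: "\<And>v. v \<in> F \<Longrightarrow> 0 \<le> level m n v"
    unfolding dyck_filter_def by (metis surj_pair)
  let ?t = "(j - j0) div int m" and ?d = "(j - j0) mod int m"
  have j: "j0 + int m * ?t + ?d = j" by simp
  have "level m n (i0 - int n * ?t, j) =
      (i0 - int n * ?t) * int m + (j0 + int m * ?t + ?d) * int n"
    unfolding j by (simp add: level_def)
  also have "\<dots> = level m n (i0, j0) + ?d * int n"
    by (simp only: level_def split algebra_simps)
  also have "\<dots> \<le> int m * int n"
    using v(2) m by (simp add: mult_right_mono order_less_imp_le)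
  finally have "x \<le> int m * int n"
    using le[OF mn_filter_move[OF F' m v(1), of j]] by linarith
  then show "x \<in> {0..int m * int n}" using ge ij by auto
qed

text \<open>Sums over infinite sets are \<open>0\<close> by convention, so finiteness makes the generating functions
  of \<open>area\<close> and \<open>dinv\<close> meaningful.\<close>

lemma finite_parking_tuples:
  assumes m: "0 < m" shows "finite (parking_tuples m n)"
proof -
  define N where "N = 2 * (int m * int n)"
  define S where "S = {F. mn_filter m n F \<and> min_levels m n F \<subseteq> {0..N}}"
  have "finite (min_levels m n ` S)"
    by (rule finite_subset[of _ "Pow {0..N}"]) (auto simp: S_def)
  moreover have "inj_on (min_levels m n) S"
    by (rule inj_on_subset[OF inj_on_min_levels[OF m]]) (auto simp: S_def)
  ultimately have S: "finite S" by (rule finite_imageD)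
  have "parking_tuples m n \<subseteq>
      {Fs. set Fs \<subseteq> S \<and> length Fs = n + 1} \<times> {ps. set ps \<subseteq> {0..N} \<and> length ps = n}"
  proof (rule subrelI)
    fix Fs ps assume "(Fs, ps) \<in> parking_tuples m n"
    then have len: "length Fs = n + 1" "length ps = n"
      and flt: "\<forall>F\<in>set Fs. mn_filter m n F" and dyck: "dyck_filter m n (Fs ! 0)"
      and p: "\<And>i. i < n \<Longrightarrow> ps ! i \<in> min_levels m n (Fs ! i)"
      and step: "\<And>i. i < n \<Longrightarrow> min_levels m n (Fs ! (i + 1)) =
              (min_levels m n (Fs ! i) - {ps ! i}) \<union> {ps ! i + int m}"
      unfolding parking_tuples_def filter_tuple_def mem_Collect_eq split by blast+
    have bd: "i \<le> n \<Longrightarrow> min_levels m n (Fs ! i) \<subseteq> {0..int m * int n + int m * int i}" for i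
    proof (induction i)
      case 0 then show ?case using dyck_min_levels[OF dyck m] by simp
    next
      case (Suc i)
      then have IH: "min_levels m n (Fs ! i) \<subseteq> {0..int m * int n + int m * int i}" and i: "i < n"
        by auto
      have "ps ! i \<in> {0..int m * int n + int m * int i}" using p[OF i] IH by blast
      then show ?case using step[OF i] IH by (fastforce simp: algebra_simps)
    qed
    have bd': "min_levels m n (Fs ! i) \<subseteq> {0..N}" if "i \<le> n" for i
    proof -
      have "int m * int i \<le> int m * int n" using that by (simp add: mult_left_mono)
      then show ?thesis using bd[OF that] unfolding N_def by fastforce
    qed
    have "set Fs \<subseteq> S"
    proof
      fix F assume F: "F \<in> set Fs"
      then obtain i where "i < n + 1" "F = Fs ! i" using len by (metis in_set_conv_nth)
      then show "F \<in> S" using F flt bd'[of i] by (simp add: S_def)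
    qed
    moreover have "set ps \<subseteq> {0..N}"
    proof
      fix x assume "x \<in> set ps"
      then obtain i where "i < n" "x = ps ! i" using len by (auto simp: in_set_conv_nth)
      then show "x \<in> {0..N}" using p[of i] bd'[of i] by auto
    qed
    ultimately show "(Fs, ps) \<in> {Fs. set Fs \<subseteq> S \<and> length Fs = n + 1} \<times>
        {ps. set ps \<subseteq> {0..N} \<and> length ps = n}" using len by simp
  qed
  then show ?thesis
    by (rule finite_subset) (intro finite_cartesian_product finite_lists_length_eq S; simp)
qed

end

theory Submission
  imports Defs "HOL-Combinatorics.Transposition"
begin

text \<open>Both \<open>A\<close> and \<open>B\<close> are bijections from the parking tuples onto the parking words.
  For \<open>A\<close> this is explicit: the \<open>A\<close>-word says which residue class moves in each step, and the
  closing condition then determines all levels. The \<open>B\<close>-word is a parking word since the sum of the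
  \<open>i\<close> lowest levels grows by \<open>i n\<close> in total but by at most \<open>m\<close> per step. By cardinality it remains to
  see that \<open>B\<close> is injective. Given two tuples with equal \<open>B\<close>-words, match the level sets at each time
  in increasing order. This matching is the unique one of least sum of squared displacements. A step
  moves matched levels by the same amount, so the least cost never increases; as it returns to its
  initial value, each step carries the order matching to the order matching. The displacement is then
  constant along residue classes and invariant under adding \<open>n\<close>, hence constant by coprimality,
  and zero because both tuples start at minimum \<open>0\<close>.\<close>

section \<open>Ranks and order matchings\<close>

text \<open>The letters of \<open>B_word\<close> are such ranks, taken in the minimal level
  sets.\<close>

definition rank :: "'a::linorder set \<Rightarrow> 'a \<Rightarrow> nat" where
  "rank M x = card {y \<in> M. y < x}"

lemma rank_less:
  assumes "finite M" "x \<in> M" "x < y" shows "rank M x < rank M y"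
  unfolding rank_def using assms by (intro psubset_card_mono) auto

lemma rank_less_iff:
  assumes "finite M" "x \<in> M" "y \<in> M" shows "rank M x < rank M y \<longleftrightarrow> x < y"
  using rank_less[of M x y] rank_less[of M y x] assms by (metis less_asym less_linear)

lemma bij_betw_rank:
  assumes "finite M" shows "bij_betw (rank M) M {..<card M}"
proof -
  have inj: "inj_on (rank M) M"
    by (rule inj_onI) (metis assms less_irrefl linorder_neqE rank_less)
  moreover have "rank M ` M \<subseteq> {..<card M}"
    unfolding rank_def using assms by (auto intro!: psubset_card_mono)
  ultimately have "rank M ` M = {..<card M}"
    by (intro card_subset_eq) (auto simp: card_image)
  with inj show ?thesis by (simp add: bij_betw_def)
qed

lemma rank_strict_mono_image:
  assumes f: "bij_betw f M N" and mono: "strict_mono_on M f" and x: "x \<in> M"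
  shows "rank N (f x) = rank M x"
proof -
  have "{y \<in> N. y < f x} = f ` {z \<in> M. z < x}"
    using f mono x unfolding bij_betw_def
    by (auto simp: strict_mono_on_less)
  moreover have "inj_on f {z \<in> M. z < x}"
    using f by (auto simp: bij_betw_def inj_on_def)
  ultimately show ?thesis by (simp add: rank_def card_image)
qed

text \<open>The increasing bijection between finite sets of equal size, encoded through ranks so
  that two elements are matched as soon as their ranks agree.\<close>

definition matching :: "'a::linorder set \<Rightarrow> 'b::linorder set \<Rightarrow> 'a \<Rightarrow> 'b" where
  "matching M N x = inv_into N (rank N) (rank M x)"

lemma
  assumes "finite M" "finite N" "card M = card N"
  shows bij_betw_matching: "bij_betw (matching M N) M N"
    and rank_matching: "x \<in> M \<Longrightarrow> rank N (matching M N x) = rank M x"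
    and strict_mono_matching: "strict_mono_on M (matching M N)"
proof -
  have M: "bij_betw (rank M) M {..<card N}" and N: "bij_betw (rank N) N {..<card N}"
    using bij_betw_rank assms by metis+
  have "bij_betw (inv_into N (rank N) \<circ> rank M) M N"
    by (rule bij_betw_trans[OF M bij_betw_inv_into[OF N]])
  moreover have "inv_into N (rank N) \<circ> rank M = matching M N"
    by (auto simp: matching_def)
  ultimately show bij: "bij_betw (matching M N) M N" by simp
  have rk: "rank N (matching M N x) = rank M x" if "x \<in> M" for x
    unfolding matching_def using bij_betwE[OF M] that
    by (metis N bij_betw_inv_into_right)
  then show "x \<in> M \<Longrightarrow> rank N (matching M N x) = rank M x" .
  show "strict_mono_on M (matching M N)"
    by (rule strict_mono_onI)
      (metis assms(1,2) bij bij_betwE rank_less_iff rk)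
qed

lemma matching_eqI:
  assumes "finite N" "y \<in> N" "rank N y = rank M x" shows "matching M N x = y"
  unfolding matching_def assms(3)[symmetric]
  by (rule inv_into_f_f) (use assms bij_betw_rank in \<open>auto simp: bij_betw_def\<close>)

text \<open>Strictly increasing bijections preserve ranks, and the rank determines an element of
  \<open>N\<close>; this is the uniqueness of the order matching.\<close>

lemma strict_mono_eq_matching:
  assumes "finite N" "bij_betw f M N" "strict_mono_on M f" "x \<in> M"
  shows "f x = matching M N x"
  using matching_eqI[of N "f x" M x] rank_strict_mono_image[OF assms(2-4)] assms
  by (simp add: bij_betwE)

section \<open>Squared displacement and the optimality of the order matching\<close>

definition cost :: "int set \<Rightarrow> (int \<Rightarrow> int) \<Rightarrow> int" where
  "cost M f = (\<Sum>x\<in>M. (x - f x)\<^sup>2)"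

text \<open>Exchanging the values at an inverted pair \<open>x < y\<close> lowers the cost by
  \<open>2 * (y - x) * (f x - f y)\<close>.\<close>

lemma cost_uncross:
  assumes fin: "finite M" and f: "bij_betw f M N" and nm: "\<not> strict_mono_on M f"
  obtains g where "bij_betw g M N" "cost M g < cost M f"
proof -
  obtain x y where xy: "x \<in> M" "y \<in> M" "x < y" "\<not> f x < f y"
    using nm by (auto simp: strict_mono_on_def)
  have "f x \<noteq> f y" using xy f by (metis bij_betw_inv_into_left less_irrefl)
  with xy have lt: "f y < f x" by simp
  let ?g = "f \<circ> transpose x y"
  have "bij_betw ?g M N"
    by (rule bij_betw_trans[OF _ f]) (use xy in \<open>simp only: bij_betw_transpose_iff\<close>)
  moreover have "cost M ?g < cost M f"
  proof -
    have split: "cost M h = (x - h x)\<^sup>2 + (y - h y)\<^sup>2 + (\<Sum>z\<in>M - {x} - {y}. (z - h z)\<^sup>2)" for h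
      unfolding cost_def using xy fin
      by (simp add: sum.remove[of M x] sum.remove[of "M - {x}" y])
    have "0 < (y - x) * (f x - f y)" using xy lt by simp
    then have "(x - f y)\<^sup>2 + (y - f x)\<^sup>2 < (x - f x)\<^sup>2 + (y - f y)\<^sup>2"
      by (simp add: power2_eq_square algebra_simps)
    moreover have "(\<Sum>z\<in>M - {x} - {y}. (z - ?g z)\<^sup>2) = (\<Sum>z\<in>M - {x} - {y}. (z - f z)\<^sup>2)"
      by (rule sum.cong) (auto simp: transpose_def)
    ultimately show ?thesis unfolding split by (simp add: transpose_def)
  qed
  ultimately show thesis by (rule that)
qed

text \<open>Uncrossing lowers a nonnegative integer, hence it ends, necessarily at the increasing
  bijection. The disjunction records both that \<open>matching M N\<close> is optimal and that no
  other bijection is.\<close>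

lemma cost_matching_aux:
  assumes "finite M" "finite N" "bij_betw f M N"
  shows "cost M (matching M N) < cost M f \<or> (\<forall>x\<in>M. f x = matching M N x)"
  using assms(3)
proof (induction "nat (cost M f)" arbitrary: f rule: less_induct)
  case less
  show ?case
  proof (cases "strict_mono_on M f")
    case True
    then show ?thesis using strict_mono_eq_matching assms less.prems by blast
  next
    case False
    then obtain g where g: "bij_betw g M N" "cost M g < cost M f"
      using cost_uncross assms(1) less.prems by blast
    have "0 \<le> cost M g" by (simp add: cost_def sum_nonneg)
    with g less.hyps[of g] have "cost M (matching M N) < cost M g \<or> (\<forall>x\<in>M. g x = matching M N x)"
      by simp
    moreover have "cost M g = cost M (matching M N)" if "\<forall>x\<in>M. g x = matching M N x"
      unfolding cost_def using that by (intro sum.cong) auto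
    ultimately show ?thesis using g(2) by fastforce
  qed
qed

lemma cost_matching_le:
  assumes "finite M" "finite N" "bij_betw f M N"
  shows "cost M (matching M N) \<le> cost M f"
proof -
  have "cost M f = cost M (matching M N)" if "\<forall>x\<in>M. f x = matching M N x"
    unfolding cost_def using that by (intro sum.cong) auto
  then show ?thesis using cost_matching_aux[OF assms] by fastforce
qed

lemma eq_matching_if_cost_le:
  assumes "finite M" "finite N" "bij_betw f M N" "cost M f \<le> cost M (matching M N)" "x \<in> M"
  shows "f x = matching M N x"
  using cost_matching_aux[OF assms(1-3)] assms(4,5) by auto

section \<open>Sums of the lowest elements\<close>

definition low :: "nat \<Rightarrow> int set \<Rightarrow> int set" where
  "low i M = {x \<in> M. rank M x < i}"

lemma card_low:
  assumes "finite M" "i \<le> card M" shows "card (low i M) = i"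
proof -
  have "bij_betw (rank M) (low i M) {..<i}"
  proof (rule bij_betw_subset[OF bij_betw_rank[OF assms(1)]])
    show "rank M ` low i M = {..<i}"
    proof
      show "{..<i} \<subseteq> rank M ` low i M"
      proof
        fix k assume "k \<in> {..<i}"
        then have "k \<in> rank M ` M"
          using bij_betw_rank[OF assms(1)] assms(2) by (auto simp: bij_betw_def)
        with \<open>k \<in> {..<i}\<close> show "k \<in> rank M ` low i M" by (auto simp: low_def)
      qed
    qed (auto simp: low_def)
  qed (auto simp: low_def)
  then show ?thesis by (simp add: bij_betw_same_card)
qed

text \<open>Outside their intersection the two sets have equally many elements, and there each
  element of \<open>low i M\<close> is smaller than each element of \<open>T\<close>.\<close>

lemma sum_low_le:
  assumes fin: "finite M" and T: "T \<subseteq> M" "card T = i"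
  shows "\<Sum>(low i M) \<le> \<Sum>T"
proof -
  let ?S = "low i M"
  have S: "?S \<subseteq> M" by (auto simp: low_def)
  have finS: "finite ?S" "finite T" using S T fin finite_subset by blast+
  have "card ?S = card T" using card_low[OF fin] T fin by (metis card_mono)
  then have card: "card (?S - T) = card (T - ?S)"
    using finS by (metis card_Diff_subset_Int finite_Int inf_commute)
  have lt: "x < y" if "x \<in> ?S" "y \<in> T - ?S" for x y
    using that T rank_less_iff[OF fin, of x y] by (auto simp: low_def)
  have "\<Sum>(?S - T) \<le> \<Sum>(T - ?S)"
  proof (cases "?S - T = {}")
    case True
    with card finS have "T - ?S = {}" by (metis card_0_eq card.empty finite_Diff)
    show ?thesis unfolding True \<open>T - ?S = {}\<close> by simp
  next
    case False
    \<comment> \<open>\<open>c\<close> separates the two differences, so both sums compare with the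
      same multiple of \<open>c\<close>.\<close>
    define c where "c = Max (?S - T)"
    have "c \<in> ?S - T" unfolding c_def using False finS by (intro Max_in) auto
    have "\<Sum>(?S - T) \<le> of_nat (card (?S - T)) * c"
      unfolding c_def using finS by (intro sum_bounded_above) auto
    also have "\<dots> \<le> \<Sum>(T - ?S)"
      unfolding card using lt \<open>c \<in> _\<close> by (intro sum_bounded_below) (auto intro: less_imp_le)
    finally show ?thesis .
  qed
  moreover have "\<Sum>?S = \<Sum>(?S \<inter> T) + \<Sum>(?S - T)" "\<Sum>T = \<Sum>(?S \<inter> T) + \<Sum>(T - ?S)"
    using sum.Int_Diff[OF finS(1), of "\<lambda>x. x" T] sum.Int_Diff[OF finS(2), of "\<lambda>x. x" ?S]
    by (simp_all add: Int_commute)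
  ultimately show ?thesis by linarith
qed

section \<open>Circuits of residue systems\<close>

definition residue_system :: "nat \<Rightarrow> int set \<Rightarrow> bool" where
  "residue_system m M \<longleftrightarrow> (\<forall>r. \<exists>!x. x \<in> M \<and> [x = r] (mod int m))"

lemma residue_systemE:
  assumes "residue_system m M" obtains x where "x \<in> M" "[x = r] (mod int m)"
  using assms unfolding residue_system_def by blast

lemma residue_system_unique:
  assumes "residue_system m M" "x \<in> M" "y \<in> M" "[x = y] (mod int m)" shows "x = y"
  using assms unfolding residue_system_def by (metis cong_refl)

lemma
  assumes M: "residue_system m M" and m: "0 < m"
  shows finite_residue_system: "finite M" and card_residue_system: "card M = m"
proof -
  have inj: "inj_on (\<lambda>x. x mod int m) M"
    by (rule inj_onI) (use residue_system_unique[OF M] in \<open>simp add: cong_def\<close>)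
  have "(\<lambda>x. x mod int m) ` M = {0..<int m}"
  proof
    show "{0..<int m} \<subseteq> (\<lambda>x. x mod int m) ` M"
    proof
      fix r assume r: "r \<in> {0..<int m}"
      obtain x where "x \<in> M" "[x = r] (mod int m)" using residue_systemE[OF M] .
      with r show "r \<in> (\<lambda>x. x mod int m) ` M" by (force simp: cong_def)
    qed
  qed (use m in auto)
  with inj have bij: "bij_betw (\<lambda>x. x mod int m) M {0..<int m}" by (simp add: bij_betw_def)
  show "finite M" using bij_betw_finite[OF bij] by simp
  show "card M = m" using bij_betw_same_card[OF bij] by simp
qed

text \<open>A filter tuple reduced to its level sets as functions of time. Minimum \<open>0\<close>
  at the start is a separate condition, which fixes the translate.\<close>

definition circuit :: "nat \<Rightarrow> nat \<Rightarrow> (nat \<Rightarrow> int set) \<Rightarrow> (nat \<Rightarrow> int) \<Rightarrow> bool" where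
  "circuit m n M p \<longleftrightarrow>
     (\<forall>t\<le>n. residue_system m (M t)) \<and>
     (\<forall>t<n. p t \<in> M t \<and> M (Suc t) = M t - {p t} \<union> {p t + int m}) \<and>
     M n = (\<lambda>x. x + int n) ` M 0"

lemma
  assumes "circuit m n M p"
  shows circuit_residue_system: "t \<le> n \<Longrightarrow> residue_system m (M t)"
    and circuit_mem: "t < n \<Longrightarrow> p t \<in> M t"
    and circuit_Suc: "t < n \<Longrightarrow> M (Suc t) = M t - {p t} \<union> {p t + int m}"
    and circuit_end: "M n = (\<lambda>x. x + int n) ` M 0"
  using assms unfolding circuit_def by blast+

text \<open>\<open>M t\<close> already contains \<open>p t\<close> in this residue class, so a step
  brings in a genuinely new element.\<close>

lemma circuit_not_mem:
  assumes "circuit m n M p" "0 < m" "t < n" shows "p t + int m \<notin> M t"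
proof
  assume "p t + int m \<in> M t"
  then have "p t + int m = p t"
    using residue_system_unique[OF circuit_residue_system[OF assms(1)], of t]
      circuit_mem[OF assms(1,3)] assms(3) by (meson cong_add_rcancel_0 cong_refl less_imp_le cong_def mod_add_self2)
  with assms(2) show False by simp
qed

text \<open>A step can raise the sum of the \<open>i\<close> lowest levels only if it moves one of
  them, and then by at most \<open>m\<close>, while the closing translation raises it by
  \<open>i * n\<close> in total. For the \<open>B_word\<close> of a tuple this is the parking
  inequality.\<close>

lemma circuit_rank_bound:
  assumes c: "circuit m n M p" and m: "0 < m" and i: "i \<le> m"
  shows "i * n \<le> m * card {j. j < n \<and> rank (M j) (p j) < i}"
proof -
  have fin: "finite (M t)" and card: "card (M t) = m" if "t \<le> n" for t
    using finite_residue_system card_residue_system circuit_residue_system[OF c that] m by blast+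
  have step: "\<Sum>(low i (M t)) \<le> \<Sum>(low i (M 0)) + int (m * card {j. j < t \<and> rank (M j) (p j) < i})"
    if "t \<le> n" for t
    using that
  proof (induction t)
    case (Suc t)
    then have t: "t < n" by simp
    let ?L = "low i (M t)"
    have L: "card ?L = i" using card_low fin card i t by simp
    have finL: "finite ?L" using fin[of t] t by (simp add: low_def)
    have new: "p t + int m \<notin> ?L" using circuit_not_mem[OF c m t] by (auto simp: low_def)
    show ?case
    proof (cases "rank (M t) (p t) < i")
      case True
      have p: "p t \<in> ?L" using circuit_mem[OF c t] True by (simp add: low_def)
      have "{j. j < Suc t \<and> rank (M j) (p j) < i} = insert t {j. j < t \<and> rank (M j) (p j) < i}"
        using True less_Suc_eq by auto
      then have cnt: "card {j. j < Suc t \<and> rank (M j) (p j) < i} =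
          Suc (card {j. j < t \<and> rank (M j) (p j) < i})" by simp
      \<comment> \<open>After the move of \<open>p t\<close> these \<open>i\<close> levels need not
        be the lowest any more, but their sum bounds the new lowest sum from above.\<close>
      let ?T = "insert (p t + int m) (?L - {p t})"
      have T: "?T \<subseteq> M (Suc t)" using circuit_Suc[OF c t] by (auto simp: low_def)
      have "card ?T = i" using finL new p L card_Suc_Diff1[OF finL p] by simp
      from sum_low_le[OF fin[OF Suc.prems] T this]
      have "\<Sum>(low i (M (Suc t))) \<le> \<Sum>?T" .
      also have "\<dots> = \<Sum>?L + int m"
        using finL new p by (simp add: sum_diff1)
      finally show ?thesis unfolding cnt using Suc by (simp add: algebra_simps)
    next
      case False
      have cnt: "{j. j < Suc t \<and> rank (M j) (p j) < i} = {j. j < t \<and> rank (M j) (p j) < i}"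
        using False less_Suc_eq by auto
      \<comment> \<open>A move of rank at least \<open>i\<close> leaves all \<open>i\<close> lowest
        levels in place.\<close>
      have T: "?L \<subseteq> M (Suc t)" using circuit_Suc[OF c t] False by (auto simp: low_def)
      from sum_low_le[OF fin[OF Suc.prems] T L] show ?thesis unfolding cnt using Suc by simp
    qed
  qed simp
  \<comment> \<open>Translating the final \<open>i\<close> lowest levels back by \<open>n\<close>
    gives \<open>i\<close> elements of \<open>M 0\<close>, whose sum is at least the initial lowest
    sum.\<close>
  define T where "T = (\<lambda>x. x - int n) ` low i (M n)"
  have inj: "inj_on (\<lambda>x. x - int n) A" for A by (simp add: inj_on_def)
  have "T \<subseteq> M 0" unfolding T_def using circuit_end[OF c] by (auto simp: low_def)
  moreover have cardL: "card (low i (M n)) = i" using card_low fin card i by simp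
  then have "card T = i" unfolding T_def by (simp add: card_image inj)
  ultimately have "\<Sum>(low i (M 0)) \<le> \<Sum>T" using sum_low_le fin by blast
  also have "\<dots> = \<Sum>(low i (M n)) - int i * int n"
    unfolding T_def by (simp add: sum.reindex inj sum_subtractf cardL)
  finally have "int i * int n \<le> int (m * card {j. j < n \<and> rank (M j) (p j) < i})"
    using step[of n] by simp
  then show ?thesis by (metis of_nat_le_iff of_nat_mult)
qed

text \<open>Since \<open>n\<close> is invertible modulo \<open>m\<close>, every residue class is
  reached from that of \<open>x\<close> by adding \<open>n\<close> repeatedly.\<close>

lemma constant_on_residue_system:
  fixes f :: "int \<Rightarrow> 'a"
  assumes M: "residue_system m M" and co: "coprime m n"
    and shift: "\<And>x y. x \<in> M \<Longrightarrow> y \<in> M \<Longrightarrow> [y = x + int n] (mod int m) \<Longrightarrow> f y = f x"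
    and m: "0 < m" and x: "x \<in> M" and y: "y \<in> M"
  shows "f y = f x"
proof -
  have k: "f z = f x" if "z \<in> M" "[z = x + int k * int n] (mod int m)" for k z
    using that
  proof (induction k arbitrary: z)
    case 0
    then have "z = x" using residue_system_unique[OF M _ x] by simp
    then show ?case by simp
  next
    case (Suc k)
    obtain w where w: "w \<in> M" "[w = x + int k * int n] (mod int m)" using residue_systemE[OF M] .
    have "[w + int n = x + int k * int n + int n] (mod int m)" using w(2) by (simp add: cong_add)
    then have "[z = w + int n] (mod int m)"
      using Suc.prems(2) by (simp add: algebra_simps cong_def)
    then have "f z = f w" using shift w(1) Suc.prems(1) by blast
    then show ?case using Suc.IH[OF w] by simp
  qed
  have "coprime (int n) (int m)" using co by (simp add: coprime_commute)
  then obtain b where b: "[int n * b = 1] (mod int m)" using cong_solve_coprime_int by blast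
  \<comment> \<open>\<open>b\<close> inverts \<open>n\<close> modulo \<open>m\<close>, so
    \<open>k\<close> steps of length \<open>n\<close> lead from the class of \<open>x\<close> to
    that of \<open>y\<close>; the reduction modulo \<open>m\<close> keeps \<open>k\<close>
    nonnegative.\<close>
  define k where "k = nat ((b * (y - x)) mod int m)"
  have "int k = (b * (y - x)) mod int m" unfolding k_def using m by simp
  then have "[int k = b * (y - x)] (mod int m)" by (simp add: cong_def)
  then have "[int k * int n = b * (y - x) * int n] (mod int m)" by (rule cong_scalar_right)
  also have "b * (y - x) * int n = (int n * b) * (y - x)" by (simp add: algebra_simps)
  also have "[\<dots> = 1 * (y - x)] (mod int m)" using b by (rule cong_scalar_right)
  finally have "[x + int k * int n = x + (y - x)] (mod int m)" by (intro cong_add) auto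
  then have "[y = x + int k * int n] (mod int m)" by (simp add: cong_sym)
  from k[OF y this] show ?thesis .
qed

text \<open>Transport of a matching through a step preserves its cost, and passing to the order
  matching cannot raise it. The closing translation brings the cost back to its start, so equality
  holds throughout and uniqueness of the optimum identifies the transported matchings with the order
  matchings.\<close>

lemma
  assumes c: "circuit m n M p" and d: "circuit m n N q" and m: "0 < m"
    and rank: "\<forall>t<n. rank (M t) (p t) = rank (N t) (q t)"
  shows circuit_matching_Suc: "t < n \<Longrightarrow> x \<in> M (Suc t) \<Longrightarrow> matching (M (Suc t)) (N (Suc t)) x =
          ((matching (M t) (N t)) (p t + int m := q t + int m)) x"
    and circuit_matching_end: "x \<in> M 0 \<Longrightarrow> matching (M n) (N n) (x + int n) =
          matching (M 0) (N 0) x + int n"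
proof -
  define \<phi> where "\<phi> t = matching (M t) (N t)" for t
  \<comment> \<open>\<open>g t\<close> carries the order matching across step \<open>t\<close>;
    \<open>h\<close> pulls the final matching back to the initial sets along the translation by
    \<open>n\<close>.\<close>
  define g where "g t = (\<phi> t) (p t + int m := q t + int m)" for t
  define h where "h x = \<phi> n (x + int n) - int n" for x
  note resM = circuit_residue_system[OF c] and resN = circuit_residue_system[OF d]
  have fin: "finite (M t)" "finite (N t)" and card: "card (M t) = card (N t)" if "t \<le> n" for t
    using finite_residue_system[OF resM[OF that] m] finite_residue_system[OF resN[OF that] m]
      card_residue_system[OF resM[OF that] m] card_residue_system[OF resN[OF that] m] by simp_all
  have bij: "bij_betw (\<phi> t) (M t) (N t)" if "t \<le> n" for t
    unfolding \<phi>_def by (intro bij_betw_matching fin card that)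
  \<comment> \<open>Equal ranks make the moved elements \<open>p t\<close> and \<open>q t\<close>
    partners.\<close>
  have p: "\<phi> t (p t) = q t" if "t < n" for t
    unfolding \<phi>_def using that rank
    by (intro matching_eqI fin circuit_mem[OF d]) simp_all
  have g: "bij_betw (g t) (M (Suc t)) (N (Suc t))" and cost_g: "cost (M (Suc t)) (g t) = cost (M t) (\<phi> t)"
    if t: "t < n" for t
  proof -
    have new: "p t + int m \<notin> M t" "q t + int m \<notin> N t"
      using circuit_not_mem[OF c m t] circuit_not_mem[OF d m t] .
    have g_old: "g t x = \<phi> t x" if "x \<in> M t" for x
      using that new unfolding g_def by auto
    have "bij_betw (\<phi> t) (M t - {p t}) (N t - {q t})"
      using bij_betw_DiffI[OF bij, of t "{p t}" "{q t}"] p[OF t] t circuit_mem[OF c t] circuit_mem[OF d t]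
      by (simp add: bij_betw_def)
    then have 1: "bij_betw (g t) (M t - {p t}) (N t - {q t})"
      using g_old by (subst bij_betw_cong[of _ _ "\<phi> t"]) auto
    have 2: "bij_betw (g t) {p t + int m} {q t + int m}" by (simp add: g_def bij_betw_def)
    show "bij_betw (g t) (M (Suc t)) (N (Suc t))"
      unfolding circuit_Suc[OF c t] circuit_Suc[OF d t]
      by (rule bij_betw_combine[OF 1 2]) (use new in auto)
    \<comment> \<open>The new pair has the displacement of the old one, since both members move by
      \<open>m\<close>.\<close>
    have "cost (M (Suc t)) (g t) = (p t - q t)\<^sup>2 + (\<Sum>x\<in>M t - {p t}. (x - g t x)\<^sup>2)"
      unfolding cost_def circuit_Suc[OF c t] using fin[of t] t new by (simp add: g_def)
    also have "(\<Sum>x\<in>M t - {p t}. (x - g t x)\<^sup>2) = (\<Sum>x\<in>M t - {p t}. (x - \<phi> t x)\<^sup>2)"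
      using g_old by (intro sum.cong) auto
    also have "(p t - q t)\<^sup>2 + \<dots> = cost (M t) (\<phi> t)"
      unfolding cost_def using fin[of t] t circuit_mem[OF c t] p[OF t]
      by (simp add: sum.remove[of "M t" "p t"])
    finally show "cost (M (Suc t)) (g t) = cost (M t) (\<phi> t)" .
  qed
  have dec: "cost (M (Suc t)) (\<phi> (Suc t)) \<le> cost (M t) (\<phi> t)" if "t < n" for t
    using cost_matching_le[OF fin[of "Suc t"] g[OF that]] that
    unfolding cost_g[OF that] by (simp add: \<phi>_def)
  have anti: "cost (M t) (\<phi> t) \<le> cost (M s) (\<phi> s)" if "s \<le> t" "t \<le> n" for s t
    using that by (induction t rule: dec_induct) (auto intro: order_trans[OF dec])
  have h: "bij_betw h (M 0) (N 0)"
  proof -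
    have "bij_betw (\<lambda>x. x + int n) (M 0) (M n)"
      using circuit_end[OF c] by (simp add: bij_betw_def)
    moreover have "bij_betw (\<lambda>x. x - int n) (N n) (N 0)"
      using circuit_end[OF d] by (auto simp: bij_betw_def inj_on_def image_image)
    ultimately have "bij_betw ((\<lambda>x. x - int n) \<circ> (\<phi> n \<circ> (\<lambda>x. x + int n))) (M 0) (N 0)"
      using bij[OF order_refl] bij_betw_trans by blast
    then show ?thesis by (simp add: h_def[abs_def] o_def)
  qed
  have cost_h: "cost (M 0) h = cost (M n) (\<phi> n)"
    unfolding cost_def circuit_end[OF c] h_def by (simp add: sum.reindex algebra_simps)
  \<comment> \<open>The inequalities run once around the circuit: from \<open>g t\<close> back to
    time \<open>0\<close>, over \<open>h\<close> to time \<open>n\<close>, and down to time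
    \<open>Suc t\<close>. Hence \<open>g t\<close> is optimal there.\<close>
  have "\<phi> (Suc t) x = g t x" if t: "t < n" and x: "x \<in> M (Suc t)" for t x
  proof -
    have "cost (M (Suc t)) (g t) \<le> cost (M 0) (\<phi> 0)"
      using cost_g[OF t] anti[of 0 t] t by simp
    also have "\<dots> \<le> cost (M 0) h"
      unfolding \<phi>_def using cost_matching_le fin h by blast
    also have "\<dots> \<le> cost (M (Suc t)) (\<phi> (Suc t))"
      unfolding cost_h using anti[of "Suc t" n] t by simp
    finally show ?thesis
      using eq_matching_if_cost_le[OF fin g[OF t] _ x] t by (simp add: \<phi>_def)
  qed
  then show "t < n \<Longrightarrow> x \<in> M (Suc t) \<Longrightarrow> matching (M (Suc t)) (N (Suc t)) x =
          ((matching (M t) (N t)) (p t + int m := q t + int m)) x"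
    by (simp add: g_def \<phi>_def)
  show "matching (M n) (N n) (x + int n) = matching (M 0) (N 0) x + int n" if "x \<in> M 0"
    using eq_matching_if_cost_le[OF fin h _ that] anti[of 0 n] cost_h
    by (simp add: \<phi>_def h_def)
qed

text \<open>Partners move together by \<open>m\<close>, so their displacement depends only on the
  residue class. The closing translation makes it invariant under adding \<open>n\<close>, so it is
  constant and \<open>N 0\<close> is a translate of \<open>M 0\<close>.\<close>

lemma circuit_rank_inj_start:
  assumes c: "circuit m n M p" and d: "circuit m n N q" and m: "0 < m" and co: "coprime m n"
    and rank: "\<forall>t<n. rank (M t) (p t) = rank (N t) (q t)"
    and M0: "0 \<in> M 0" "\<And>x. x \<in> M 0 \<Longrightarrow> 0 \<le> x" and N0: "0 \<in> N 0" "\<And>x. x \<in> N 0 \<Longrightarrow> 0 \<le> x"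
  shows "M 0 = N 0"
proof -
  note matching_Suc = circuit_matching_Suc[OF c d m rank]
    and matching_end = circuit_matching_end[OF c d m rank]
  note resM = circuit_residue_system[OF c] and resN = circuit_residue_system[OF d]
  have fin: "finite (M t)" "finite (N t)" and card: "card (M t) = card (N t)" if "t \<le> n" for t
    using finite_residue_system[OF resM[OF that] m] finite_residue_system[OF resN[OF that] m]
      card_residue_system[OF resM[OF that] m] card_residue_system[OF resN[OF that] m] by simp_all
  define \<delta> where "\<delta> t x = x - matching (M t) (N t) x" for t x
  have \<delta>: "\<delta> t x = \<delta> 0 y" if "t \<le> n" "x \<in> M t" "y \<in> M 0" "[x = y] (mod int m)" for t x y
    using that
  proof (induction t arbitrary: x)
    case 0
    then show ?case using residue_system_unique[OF resM] by blast
  next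
    case (Suc t)
    then have t: "t < n" by simp
    show ?case
    proof (cases "x = p t + int m")
      case True
      have "matching (M t) (N t) (p t) = q t"
        using t rank by (intro matching_eqI fin circuit_mem[OF d]) simp_all
      moreover have "matching (M (Suc t)) (N (Suc t)) x = q t + int m"
        using matching_Suc[OF t Suc.prems(2)] True by simp
      ultimately have "\<delta> (Suc t) x = \<delta> t (p t)" unfolding \<delta>_def using True by simp
      moreover have "[p t = y] (mod int m)" using Suc.prems(4) True by (simp add: cong_def)
      ultimately show ?thesis using Suc.IH circuit_mem[OF c t] t Suc.prems(3) by simp
    next
      case False
      then have "x \<in> M t" using Suc.prems(2) circuit_Suc[OF c t] by blast
      moreover have "\<delta> (Suc t) x = \<delta> t x"
        unfolding \<delta>_def matching_Suc[OF t Suc.prems(2)] using False by simp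
      ultimately show ?thesis using Suc.IH t Suc.prems by simp
    qed
  qed
  have shift: "\<delta> 0 y = \<delta> 0 x" if "x \<in> M 0" "y \<in> M 0" "[y = x + int n] (mod int m)" for x y
  proof -
    have "x + int n \<in> M n" using circuit_end[OF c] that(1) by blast
    then have "\<delta> n (x + int n) = \<delta> 0 y" using \<delta>[of n] that by (simp add: cong_sym)
    moreover have "\<delta> n (x + int n) = \<delta> 0 x" unfolding \<delta>_def using matching_end[OF that(1)] by simp
    ultimately show ?thesis by simp
  qed
  define s where "s = \<delta> 0 0"
  have "\<delta> 0 x = s" if "x \<in> M 0" for x
    unfolding s_def using constant_on_residue_system[OF resM[OF le0] co _ m M0(1) that, of "\<delta> 0"] shift by blast
  then have match: "matching (M 0) (N 0) x = x - s" if "x \<in> M 0" for x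
    using that by (force simp: \<delta>_def)
  have "bij_betw (matching (M 0) (N 0)) (M 0) (N 0)"
    by (intro bij_betw_matching fin card le0)
  then have "N 0 = matching (M 0) (N 0) ` M 0" by (simp only: bij_betw_def)
  also have "\<dots> = (\<lambda>x. x - s) ` M 0" using match by (rule image_cong[OF refl])
  finally have N: "N 0 = (\<lambda>x. x - s) ` M 0" .
  \<comment> \<open>The minimum \<open>0\<close> of each set bounds \<open>s\<close> from one
    side.\<close>
  obtain x where "x \<in> M 0" "0 = x - s" using N0(1) unfolding N by blast
  then have "0 \<le> s" using M0(2)[of x] by simp
  moreover have "0 - s \<in> N 0" unfolding N using M0(1) by (rule imageI)
  then have "s \<le> 0" using N0(2)[of "0 - s"] by simp
  ultimately show ?thesis using N by simp
qed

text \<open>Once the starting sets agree, a rank in the common set determines the element that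
  moves, and this determines the next set.\<close>

lemma circuit_rank_inj:
  assumes c: "circuit m n M p" and d: "circuit m n N q" and m: "0 < m" and co: "coprime m n"
    and rank: "\<forall>t<n. rank (M t) (p t) = rank (N t) (q t)"
    and 0: "0 \<in> M 0" "\<And>x. x \<in> M 0 \<Longrightarrow> 0 \<le> x" "0 \<in> N 0" "\<And>x. x \<in> N 0 \<Longrightarrow> 0 \<le> x"
  shows "t \<le> n \<Longrightarrow> M t = N t" and "t < n \<Longrightarrow> p t = q t"
proof -
  have p: "p t = q t" if t: "t < n" and eq: "M t = N t" for t
  proof -
    have "inj_on (rank (N t)) (N t)"
      using bij_betw_rank finite_residue_system circuit_residue_system[OF d] t m
      by (metis bij_betw_def less_imp_le)
    then show ?thesis
      using rank[rule_format, OF t] circuit_mem[OF c t] circuit_mem[OF d t] eq by (simp add: inj_on_eq_iff)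
  qed
  show M: "M t = N t" if "t \<le> n" for t
    using that
  proof (induction t)
    case 0
    show ?case using circuit_rank_inj_start assms by blast
  next
    case (Suc t)
    then show ?case using p[of t] circuit_Suc[OF c, of t] circuit_Suc[OF d, of t] by simp
  qed
  show "t < n \<Longrightarrow> p t = q t" using p M by simp
qed

section \<open>Filters and their minimal levels\<close>

lemma level_surj:
  assumes "0 < m" "coprime m n" obtains i j where "level m n (i, j) = z"
proof -
  have "coprime (int n) (int m)" using assms by (simp add: coprime_commute)
  then obtain b where "[int n * b = 1] (mod int m)" using cong_solve_coprime_int by blast
  then have "[int n * b * z = 1 * z] (mod int m)" by (rule cong_scalar_right)
  then have "int m dvd z - int n * b * z" by (simp add: cong_iff_dvd_diff dvd_diff_commute)
  then obtain i where "z - int n * b * z = int m * i" ..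
  then have "level m n (i, b * z) = z" by (simp add: level_def algebra_simps)
  then show thesis by (rule that)
qed

text \<open>A row carries the levels of one residue class modulo \<open>m\<close>, and coprimality
  makes every class occur. Rows of the same class have the same minimum because membership depends
  only on the level.\<close>

lemma residue_system_min_levels:
  assumes F: "mn_filter m n F" and m: "0 < m" and co: "coprime m n"
  shows "residue_system m (min_levels m n F)"
  unfolding residue_system_def
proof (intro allI ex_ex1I)
  fix r
  obtain i j where ij: "level m n (i, j) = r" using level_surj[OF m co] .
  obtain k where k: "(k, j) \<in> F" "\<And>i'. (i', j) \<in> F \<Longrightarrow> k \<le> i'"
    using row_min[OF F m] by blast
  have "level m n (k, j) \<in> min_levels m n F"
    unfolding min_levels_def using k by (auto simp: level_def mult_right_mono)
  moreover have "[level m n (k, j) = r] (mod int m)"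
    unfolding ij[symmetric] by (simp add: level_def cong_def)
  ultimately show "\<exists>x. x \<in> min_levels m n F \<and> [x = r] (mod int m)" by blast
next
  fix r x y
  assume xr: "x \<in> min_levels m n F \<and> [x = r] (mod int m)"
    and yr: "y \<in> min_levels m n F \<and> [y = r] (mod int m)"
  have no: "\<not> u < v" if u: "u \<in> min_levels m n F" and v: "v \<in> min_levels m n F"
    and uv: "[u = v] (mod int m)" for u v
  proof
    assume "u < v"
    have dvd: "int m dvd v - u" using uv by (simp add: cong_iff_dvd_diff dvd_diff_commute)
    with \<open>u < v\<close> have le: "u \<le> v - int m" using zdvd_imp_le[of "int m" "v - u"] by simp
    from v obtain i j where ij: "v = level m n (i, j)"
      and min: "\<And>i'. (i', j) \<in> F \<Longrightarrow> v \<le> level m n (i', j)"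
      unfolding min_levels_def by blast
    \<comment> \<open>The left neighbour of the row minimum still has level at least
      \<open>u\<close> in the class of \<open>u\<close>; hence it lies in \<open>F\<close>, against
      minimality.\<close>
    have lev: "level m n (i - 1, j) = v - int m" by (simp add: ij level_def algebra_simps)
    moreover have "int m dvd v - int m - u"
      using dvd by (metis diff_diff_eq2 add.commute diff_diff_add dvd_diff dvd_refl)
    ultimately have "(i - 1, j) \<in> F"
      unfolding mem_filter_iff[OF F m] using le u by auto
    from min[OF this] lev m show False by simp
  qed
  have "[x = y] (mod int m)" using xr yr by (meson cong_sym cong_trans)
  then show "x = y" using no[of x y] no[of y x] xr yr by (meson cong_sym linorder_neqE)
qed

lemma dyck_filter_iff:
  assumes F: "mn_filter m n F" and m: "0 < m" and co: "coprime m n"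
  shows "dyck_filter m n F \<longleftrightarrow> 0 \<in> min_levels m n F \<and> (\<forall>x\<in>min_levels m n F. 0 \<le> x)"
proof
  assume d: "dyck_filter m n F"
  then obtain i j where "(i, j) \<in> F" "level m n (i, j) = 0" unfolding dyck_filter_def by auto
  then obtain x where x: "x \<in> min_levels m n F" "x \<le> 0"
    using mem_filter_iff[OF F m, of i j] by auto
  have "\<forall>x\<in>min_levels m n F. 0 \<le> x" using dyck_min_levels[OF d m] by auto
  with x show "0 \<in> min_levels m n F \<and> (\<forall>x\<in>min_levels m n F. 0 \<le> x)"
    by (metis order_antisym)
next
  assume M: "0 \<in> min_levels m n F \<and> (\<forall>x\<in>min_levels m n F. 0 \<le> x)"
  then have "\<exists>v\<in>F. level m n v = 0" unfolding min_levels_def by force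
  moreover have "0 \<le> level m n v" if "v \<in> F" for v
    using that M mem_filter_iff[OF F m, of "fst v" "snd v"] by force
  ultimately show "dyck_filter m n F" using F by (simp add: dyck_filter_def)
qed

text \<open>\<open>F\<close> collects the points whose level arises from an element of
  \<open>M\<close> by adding a nonnegative multiple of \<open>m\<close>. Moving up one row adds
  \<open>n\<close> to the level, and \<open>closed\<close> keeps the result inside
  \<open>F\<close>.\<close>

lemma mn_filter_of_residue_system:
  assumes M: "residue_system m M" and m: "0 < m" and co: "coprime m n"
    and closed: "\<And>x. x \<in> M \<Longrightarrow> \<exists>y\<in>M. y \<le> x + int n \<and> int m dvd x + int n - y"
  obtains F where "mn_filter m n F" "min_levels m n F = M"
proof -
  define F where "F = {v. \<exists>x\<in>M. x \<le> level m n v \<and> int m dvd level m n v - x}"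
  have uniq: "x = y" if "x \<in> M" "y \<in> M" "int m dvd x - y" for x y
    using residue_system_unique[OF M that(1,2)] that(3) by (simp add: cong_iff_dvd_diff)
  have up1: "(i + int k, j) \<in> F" if v: "(i, j) \<in> F" for i j k
  proof -
    obtain x where x: "x \<in> M" "x \<le> level m n (i, j)" "int m dvd level m n (i, j) - x"
      using v unfolding F_def by blast
    have lev: "level m n (i + int k, j) = level m n (i, j) + int m * int k"
      by (simp add: level_def algebra_simps)
    have "int m dvd (level m n (i, j) - x) + int m * int k" using x(3) by simp
    then have "int m dvd level m n (i + int k, j) - x" unfolding lev by (simp add: algebra_simps)
    moreover have "x \<le> level m n (i + int k, j)" unfolding lev using x(2) by (simp add: add_increasing2)
    ultimately show ?thesis using x(1) by (auto simp: F_def)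
  qed
  have up2: "(i, j + int k) \<in> F" if "(i, j) \<in> F" for i j k
  proof (induction k)
    case (Suc k)
    let ?l = "level m n (i, j + int k)"
    obtain x where x: "x \<in> M" "x \<le> ?l" "int m dvd ?l - x"
      using Suc by (auto simp: F_def)
    obtain y where y: "y \<in> M" "y \<le> x + int n" "int m dvd x + int n - y"
      using closed[OF x(1)] by blast
    have lev: "level m n (i, j + int (Suc k)) = ?l + int n"
      by (simp add: level_def algebra_simps)
    have "int m dvd (?l - x) + (x + int n - y)" using x(3) y(3) by (rule dvd_add)
    then have "int m dvd ?l + int n - y" by (simp add: algebra_simps)
    moreover have "y \<le> ?l + int n" using x y by simp
    ultimately show ?case unfolding F_def mem_Collect_eq lev using y(1) by blast
  qed (use that in simp)
  have "(i', j') \<in> F" if "(i, j) \<in> F" "i \<le> i'" "j \<le> j'" for i j i' j'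
    using up2[OF up1[OF that(1), of "nat (i' - i)"], of "nat (j' - j)"] that by simp
  moreover have "w \<in> F" if "v \<in> F" "level m n w = level m n v" for v w
    using that by (simp add: F_def)
  moreover have "F \<noteq> {}" "F \<noteq> UNIV"
  proof -
    obtain x where x: "x \<in> M" using residue_systemE[OF M] by blast
    obtain i j where ij: "level m n (i, j) = x" using level_surj[OF m co] .
    then have "(i, j) \<in> F" using x by (auto simp: F_def)
    then show "F \<noteq> {}" by blast
    \<comment> \<open>Left of a point of level \<open>x\<close> the level drops to
      \<open>x - int m\<close>, below the only element of \<open>M\<close> in its class.\<close>
    have lev: "level m n (i - 1, j) = x - int m" using ij by (simp add: level_def algebra_simps)
    have "(i - 1, j) \<notin> F"
    proof
      assume "(i - 1, j) \<in> F"
      then obtain y where y: "y \<in> M" "y \<le> x - int m" "int m dvd x - int m - y"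
        unfolding F_def mem_Collect_eq lev by blast
      have "int m dvd (x - int m - y) + int m" using y(3) dvd_refl by (rule dvd_add)
      moreover have "(x - int m - y) + int m = x - y" by simp
      ultimately have "x = y" using uniq[OF x y(1)] by metis
      with y(2) m show False by simp
    qed
    then show "F \<noteq> UNIV" by blast
  qed
  ultimately have F: "mn_filter m n F" unfolding mn_filter_def by blast
  have "min_levels m n F = M"
  proof (intro equalityI subsetI)
    fix x assume x: "x \<in> M"
    obtain i j where ij: "level m n (i, j) = x" using level_surj[OF m co] .
    have "x \<le> level m n (i', j)" if i': "(i', j) \<in> F" for i'
    proof -
      obtain y where y: "y \<in> M" "y \<le> level m n (i', j)" "int m dvd level m n (i', j) - y"
        using i' by (auto simp: F_def)
      have "level m n (i', j) = x + int m * (i' - i)"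
        unfolding ij[symmetric] by (simp add: level_def algebra_simps)
      then have "x - y = (level m n (i', j) - y) - int m * (i' - i)" by simp
      also have "int m dvd \<dots>" using y(3) dvd_triv_left by (rule dvd_diff)
      finally have "int m dvd x - y" .
      then show ?thesis using uniq[OF x y(1)] y(2) by simp
    qed
    moreover have "(i, j) \<in> F" using ij x by (auto simp: F_def)
    ultimately show "x \<in> min_levels m n F" unfolding min_levels_def using ij by blast
  next
    fix z assume "z \<in> min_levels m n F"
    then obtain i j where ij: "(i, j) \<in> F" "z = level m n (i, j)"
      and min: "\<And>i'. (i', j) \<in> F \<Longrightarrow> z \<le> level m n (i', j)"
      unfolding min_levels_def by blast
    then obtain y where y: "y \<in> M" "y \<le> z" "int m dvd z - y" by (auto simp: F_def)
    then obtain k where k: "z - y = int m * k" by (auto simp: dvd_def)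
    \<comment> \<open>Going \<open>k\<close> steps left leads to a point of level \<open>y\<close>;
      minimality of \<open>z\<close> then forces \<open>z = y\<close>.\<close>
    have lev: "level m n (i - k, j) = y" using ij(2) k by (simp add: level_def algebra_simps)
    then have "(i - k, j) \<in> F" using y by (auto simp: F_def)
    from min[OF this] lev y show "z \<in> M" by simp
  qed
  with F show thesis by (rule that)
qed

text \<open>The filters supply the residue systems required by \<open>circuit\<close>, and the Dyck
  condition becomes a condition on minimal levels, so that both words can be studied on
  circuits.\<close>

lemma parking_tuples_iff:
  assumes m: "0 < m" and co: "coprime m n"
  shows "(Fs, ps) \<in> parking_tuples m n \<longleftrightarrow>
    length Fs = n + 1 \<and> length ps = n \<and> (\<forall>F\<in>set Fs. mn_filter m n F) \<and>
    circuit m n (\<lambda>t. min_levels m n (Fs ! t)) ((!) ps) \<and>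
    0 \<in> min_levels m n (Fs ! 0) \<and> (\<forall>x\<in>min_levels m n (Fs ! 0). 0 \<le> x)"
proof (cases "length Fs = n + 1 \<and> (\<forall>F\<in>set Fs. mn_filter m n F)")
  case True
  then have flt: "mn_filter m n (Fs ! t)" if "t \<le> n" for t using that by simp
  then have "residue_system m (min_levels m n (Fs ! t))" if "t \<le> n" for t
    using residue_system_min_levels m co that by blast
  moreover have "dyck_filter m n (Fs ! 0) \<longleftrightarrow>
      0 \<in> min_levels m n (Fs ! 0) \<and> (\<forall>x\<in>min_levels m n (Fs ! 0). 0 \<le> x)"
    using dyck_filter_iff[OF flt m co] by simp
  ultimately show ?thesis
    using True by (auto simp: parking_tuples_def filter_tuple_def circuit_def)
qed (auto simp: parking_tuples_def filter_tuple_def)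

lemma parking_tuple_eqI:
  assumes m: "0 < m"
    and p: "(Fs, ps) \<in> parking_tuples m n" and q: "(Gs, qs) \<in> parking_tuples m n"
    and M: "\<And>t. t \<le> n \<Longrightarrow> min_levels m n (Fs ! t) = min_levels m n (Gs ! t)"
    and eq: "\<And>t. t < n \<Longrightarrow> ps ! t = qs ! t"
  shows "(Fs, ps) = (Gs, qs)"
proof -
  have len: "length Fs = n + 1" "length Gs = n + 1" "length ps = n" "length qs = n"
    and flt: "\<And>F. F \<in> set Fs \<union> set Gs \<Longrightarrow> mn_filter m n F"
    using p q by (auto simp: parking_tuples_def filter_tuple_def)
  have "Fs ! t = Gs ! t" if "t < n + 1" for t
    using inj_onD[OF inj_on_min_levels[OF m], of n "Fs ! t" "Gs ! t"] M[of t] flt len that by simp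
  then have "Fs = Gs" using len by (intro nth_equalityI) auto
  moreover have "ps = qs" using eq len by (intro nth_equalityI) auto
  ultimately show ?thesis by simp
qed

section \<open>The words \<open>A\<close> and \<open>B\<close>\<close>

text \<open>The element of the \<open>t\<close>-th minimal level set congruent to \<open>- n k\<close> modulo \<open>m\<close> for a parking tuple with
  \<open>A\<close>-word \<open>w\<close>: a step \<open>t\<close> with \<open>w t = k\<close> adds \<open>m\<close> to it, and the closing condition turns its
  value at time \<open>n\<close> into \<open>n\<close> plus the initial value for \<open>k + 1\<close>.\<close>

definition position :: "nat \<Rightarrow> nat \<Rightarrow> (nat \<Rightarrow> int) \<Rightarrow> nat \<Rightarrow> int \<Rightarrow> int" where
  "position m n w t k =
     int m * int (card {j. j < n \<and> w j < k} + card {j. j < t \<and> w j = k}) - int n * k"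

lemma position_Suc:
  "position m n w (Suc t) k = position m n w t k + (if w t = k then int m else 0)"
proof -
  have "{j. j < Suc t \<and> w j = k} =
      (if w t = k then insert t {j. j < t \<and> w j = k} else {j. j < t \<and> w j = k})"
    using less_Suc_eq by auto
  then have "card {j. j < Suc t \<and> w j = k} =
      card {j. j < t \<and> w j = k} + (if w t = k then 1 else 0)" by simp
  then show ?thesis by (simp add: position_def algebra_simps)
qed

text \<open>At time \<open>n\<close> the letters below \<open>k\<close> and the letters equal to
  \<open>k\<close> together are the letters below \<open>k + 1\<close>; the linear term accounts for
  the summand \<open>int n\<close>.\<close>

lemma position_end: "position m n w n k = position m n w 0 (k + 1) + int n"
proof -
  have "{j. j < n \<and> w j < k + 1} = {j. j < n \<and> w j < k} \<union> {j. j < n \<and> w j = k}" by auto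
  then have "card {j. j < n \<and> w j < k + 1} = card {j. j < n \<and> w j < k} + card {j. j < n \<and> w j = k}"
    by (simp add: card_Un_disjoint disjoint_iff)
  then show ?thesis by (simp add: position_def algebra_simps)
qed

lemma position_mono: "s \<le> t \<Longrightarrow> position m n w s k \<le> position m n w t k"
  by (induction t rule: dec_induct) (auto simp: position_Suc)

lemma position_cong: "[position m n w t k = - (int n * k)] (mod int m)"
  by (simp add: position_def cong_iff_dvd_diff)

text \<open>Multiplication by \<open>a\<close> and by \<open>- int n\<close> are inverse modulo
  \<open>m\<close>; this translates between letters and residue classes of levels.\<close>

lemma cong_neg_mult:
  assumes "[a * int n = -1] (mod int m)"
  shows "[- (int n * (a * x)) = x] (mod int m)" "[a * - (int n * x) = x] (mod int m)"
proof -
  have "[(a * int n) * - x = -1 * - x] (mod int m)" using assms by (rule cong_scalar_right)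
  then show "[- (int n * (a * x)) = x] (mod int m)" "[a * - (int n * x) = x] (mod int m)"
    by (simp_all add: algebra_simps)
qed

section \<open>Parking words and their realisation by circuits\<close>

definition parking_words :: "nat \<Rightarrow> nat \<Rightarrow> int list set" where
  "parking_words m n = {w. length w = n \<and> set w \<subseteq> {0..<int m} \<and>
     (\<forall>i\<le>m. i * n \<le> m * card {j. j < n \<and> w ! j < int i})}"

lemma finite_parking_words: "finite (parking_words m n)"
  by (rule finite_subset[OF _ finite_lists_length_eq[of "{0..<int m}" n]])
    (auto simp: parking_words_def)

text \<open>The letters say which class moves, and closing up links the initial levels of indices
  \<open>k\<close> and \<open>k + 1\<close>; starting from level \<open>0\<close> at index
  \<open>0\<close>, everything is determined. The last conclusion reaches up to \<open>k = m\<close>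
  to cover every parking inequality.\<close>

lemma circuit_position:
  assumes c: "circuit m n M p" and m: "0 < m" and a: "[a * int n = -1] (mod int m)"
    and 0: "0 \<in> M 0" and w: "\<And>t. t < n \<Longrightarrow> w t = (a * p t) mod int m"
  shows "t \<le> n \<Longrightarrow> M t = position m n w t ` {0..<int m}"
    and "t < n \<Longrightarrow> p t = position m n w t (w t)"
    and "k \<le> m \<Longrightarrow> position m n w 0 (int k) \<in> M 0"
proof -
  note res = circuit_residue_system[OF c]
  \<comment> \<open>\<open>X t k\<close> is the level at time \<open>t\<close> in the class of
    \<open>- n k\<close>. It turns out to obey the same recursions as
    \<open>position\<close>.\<close>
  define X where "X t k = (THE x. x \<in> M t \<and> [x = - (int n * k)] (mod int m))" for t k
  have X: "X t k \<in> M t" "[X t k = - (int n * k)] (mod int m)" if "t \<le> n" for t k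
    unfolding X_def using theI'[of "\<lambda>x. x \<in> M t \<and> [x = - (int n * k)] (mod int m)"]
      res[OF that] unfolding residue_system_def by blast+
  have X_eq: "X t k = x" if "t \<le> n" "x \<in> M t" "[x = - (int n * k)] (mod int m)" for t k x
    using residue_system_unique[OF res[OF that(1)] X(1)[OF that(1)] that(2)]
      X(2)[OF that(1)] that(3) by (meson cong_sym cong_trans)
  have w_range: "w t \<in> {0..<int m}" if "t < n" for t using w[OF that] m by simp
  have w_cong: "[- (int n * w t) = p t] (mod int m)" if "t < n" for t
  proof -
    have "[w t = a * p t] (mod int m)" using w[OF that] by (simp add: cong_def)
    then have "[- int n * w t = - int n * (a * p t)] (mod int m)" by (rule cong_scalar_left)
    then show ?thesis using cong_neg_mult(1)[OF a, of "p t"] by (simp add: cong_trans)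
  qed
  have p: "p t = X t (w t)" if "t < n" for t
    using X_eq[of t "p t" "w t"] circuit_mem[OF c that] w_cong[OF that] that by (simp add: cong_sym)
  have step: "X (Suc t) k = X t k + (if w t = k then int m else 0)"
    if t: "t < n" and k: "k \<in> {0..<int m}" for t k
  proof (cases "w t = k")
    case True
    have "[p t + int m = - (int n * k)] (mod int m)"
      using w_cong[OF t] True by (simp add: cong_def)
    then have "X (Suc t) k = p t + int m"
      using X_eq[of "Suc t"] circuit_Suc[OF c t] t by simp
    then show ?thesis using True p[OF t] by simp
  next
    case False
    have "X t k \<noteq> p t"
    proof
      assume "X t k = p t"
      then have "[p t = - (int n * k)] (mod int m)" using X(2)[of t k] t by simp
      then have "[a * p t = a * - (int n * k)] (mod int m)" by (rule cong_scalar_left)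
      then have "[a * p t = k] (mod int m)" using cong_neg_mult(2)[OF a] by (meson cong_trans)
      then show False using w[OF t] False k by (simp add: cong_def)
    qed
    then have "X (Suc t) k = X t k"
      using X_eq[of "Suc t"] X[of t k] circuit_Suc[OF c t] t by simp
    then show ?thesis using False by simp
  qed
  have X_pos: "X t k - X 0 k = position m n w t k - position m n w 0 k"
    if "t \<le> n" "k \<in> {0..<int m}" for t k
    using that
  proof (induction t)
    case (Suc t)
    then show ?case using step[of t k] by (simp add: position_Suc)
  qed simp
  have X_end: "X n k = X 0 (k + 1) + int n" for k
  proof (rule X_eq)
    show "X 0 (k + 1) + int n \<in> M n" using circuit_end[OF c] X(1)[of 0] by simp
    have "[X 0 (k + 1) + int n = - (int n * (k + 1)) + int n] (mod int m)"
      using X(2)[of 0 "k + 1"] by (intro cong_add) auto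
    then show "[X 0 (k + 1) + int n = - (int n * k)] (mod int m)" by (simp add: algebra_simps)
  qed simp
  \<comment> \<open>Following index \<open>k\<close> through all \<open>n\<close> steps and closing
    up gives the initial level of index \<open>k + 1\<close>.\<close>
  have X0: "X 0 (int k) = position m n w 0 (int k)" if "k \<le> m" for k
    using that
  proof (induction k)
    case 0
    have none: "{j. j < n \<and> w j < 0} = {}" using w_range by force
    have "X 0 0 = 0" using X_eq[of 0 0 0] \<open>0 \<in> M 0\<close> by simp
    then show ?case by (simp add: position_def none)
  next
    case (Suc k)
    then show ?case
      using X_end[of "int k"] position_end[of m n w "int k"] X_pos[of n "int k"]
      by (simp add: add.commute)
  qed
  then show "k \<le> m \<Longrightarrow> position m n w 0 (int k) \<in> M 0" using X(1)[of 0] by (metis le0)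
  have Xt: "X t k = position m n w t k" if "t \<le> n" "k \<in> {0..<int m}" for t k
    using X0[of "nat k"] X_pos[OF that] that by (simp add: nat_le_iff)
  show "p t = position m n w t (w t)" if "t < n"
    using p[OF that] Xt[of t "w t"] w_range[OF that] that by simp
  show "M t = position m n w t ` {0..<int m}" if t: "t \<le> n"
  proof (intro equalityI subsetI)
    fix x assume x: "x \<in> M t"
    define k where "k = (a * x) mod int m"
    have k: "k \<in> {0..<int m}" unfolding k_def using m by simp
    have "[k = a * x] (mod int m)" by (simp add: k_def cong_def)
    then have "[- int n * k = - int n * (a * x)] (mod int m)" by (rule cong_scalar_left)
    then have "[- (int n * k) = x] (mod int m)"
      using cong_neg_mult(1)[OF a, of x] by (simp add: cong_trans)
    then have "X t k = x" using X_eq[OF t x] by (simp add: cong_sym)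
    then show "x \<in> position m n w t ` {0..<int m}" using Xt[OF t k] k by force
  next
    fix x assume "x \<in> position m n w t ` {0..<int m}"
    then obtain k where "k \<in> {0..<int m}" "x = position m n w t k" by blast
    then show "x \<in> M t" using Xt[OF t] X(1)[OF t] by metis
  qed
qed

text \<open>Each step changes only the index given by its letter. At the end the index shifts by
  one, which is a cyclic permutation of \<open>{0..<int m}\<close> up to the coincidence of indices
  \<open>m\<close> and \<open>0\<close>.\<close>

lemma position_circuit:
  assumes m: "0 < m" and a: "[a * int n = -1] (mod int m)"
    and w: "\<And>t. t < n \<Longrightarrow> w t \<in> {0..<int m}"
  shows "circuit m n (\<lambda>t. position m n w t ` {0..<int m}) (\<lambda>t. position m n w t (w t))"
  unfolding circuit_def
proof (intro conjI allI impI)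
  have uniq: "k = l"
    if "k \<in> {0..<int m}" "l \<in> {0..<int m}" "[position m n w t k = position m n w t l] (mod int m)"
    for t k l
  proof -
    have "[- (int n * k) = - (int n * l)] (mod int m)"
      using that(3) position_cong by (meson cong_sym cong_trans)
    then have "[a * - (int n * k) = a * - (int n * l)] (mod int m)" by (rule cong_scalar_left)
    then have "[k = l] (mod int m)"
      using cong_neg_mult(2)[OF a] by (meson cong_sym cong_trans)
    with that show ?thesis by (simp add: cong_def)
  qed
  show "residue_system m (position m n w t ` {0..<int m})" for t
    unfolding residue_system_def
  proof (intro allI ex_ex1I)
    fix r
    define k where "k = (a * r) mod int m"
    have "[k = a * r] (mod int m)" by (simp add: k_def cong_def)
    then have "[- int n * k = - int n * (a * r)] (mod int m)" by (rule cong_scalar_left)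
    then have "[- (int n * k) = r] (mod int m)"
      using cong_neg_mult(1)[OF a, of r] by (simp add: cong_trans)
    then have "[position m n w t k = r] (mod int m)" using position_cong by (meson cong_trans)
    moreover have "k \<in> {0..<int m}" unfolding k_def using m by simp
    ultimately show "\<exists>x. x \<in> position m n w t ` {0..<int m} \<and> [x = r] (mod int m)" by blast
  next
    fix r x y
    assume x: "x \<in> position m n w t ` {0..<int m} \<and> [x = r] (mod int m)"
      and y: "y \<in> position m n w t ` {0..<int m} \<and> [y = r] (mod int m)"
    then have "[x = y] (mod int m)" by (meson cong_sym cong_trans)
    then show "x = y" using x y uniq by blast
  qed
  show "position m n w t (w t) \<in> position m n w t ` {0..<int m}" if "t < n" for t
    using w[OF that] by (rule imageI)
  show "position m n w (Suc t) ` {0..<int m} = position m n w t ` {0..<int m} - {position m n w t (w t)}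
      \<union> {position m n w t (w t) + int m}" (is "?L = ?R") if t: "t < n" for t
  proof -
    have "{0..<int m} = insert (w t) ({0..<int m} - {w t})" using w[OF t] by blast
    then have "?L = insert (position m n w (Suc t) (w t)) (position m n w (Suc t) ` ({0..<int m} - {w t}))"
      by (metis image_insert)
    also have "position m n w (Suc t) ` ({0..<int m} - {w t}) = position m n w t ` ({0..<int m} - {w t})"
      by (rule image_cong) (auto simp: position_Suc)
    also have "\<dots> = position m n w t ` {0..<int m} - {position m n w t (w t)}"
      using uniq[of _ "w t" t] w[OF t] by fastforce
    finally show ?thesis by (simp add: position_Suc)
  qed
  show "position m n w n ` {0..<int m} = (\<lambda>x. x + int n) ` position m n w 0 ` {0..<int m}"
  proof -
    have lt: "{j. j < n \<and> w j < int m} = {j. j < n}" "{j. j < n \<and> w j < 0} = {}"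
      using w by force+
    \<comment> \<open>All \<open>n\<close> letters lie in \<open>{0..<int m}\<close>, so both sides
      are \<open>0\<close>.\<close>
    have per: "position m n w 0 (int m) = position m n w 0 0"
      by (simp add: position_def lt)
    have "position m n w n ` {0..<int m} = (\<lambda>x. x + int n) ` position m n w 0 ` (\<lambda>k. k + 1) ` {0..<int m}"
      unfolding image_image by (rule image_cong[OF refl]) (rule position_end)
    also have "(\<lambda>k. k + 1) ` {0..<int m} = insert (int m) {1..<int m}"
    proof -
      have "(\<lambda>k. k + 1) ` {0..<int m} = {1..<int m + 1}"
        by simp
      then show ?thesis using m by auto
    qed
    also have "position m n w 0 ` \<dots> = position m n w 0 ` insert 0 {1..<int m}"
      by (simp add: per)
    also have "insert 0 {1..<int m} = {0..<int m}" using m by auto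
    finally show ?thesis .
  qed
qed

text \<open>Adding \<open>n\<close> to a level of index \<open>k\<close> leads to the class of index
  \<open>k - 1\<close>. The level there at time \<open>t\<close> is at most its final value, which
  exceeds the initial level of index \<open>k\<close> by \<open>n\<close>.\<close>

lemma position_closed:
  assumes m: "0 < m" and w: "\<And>j. j < n \<Longrightarrow> w j \<in> {0..<int m}" and t: "t \<le> n"
    and x: "x \<in> position m n w t ` {0..<int m}"
  shows "\<exists>y\<in>position m n w t ` {0..<int m}. y \<le> x + int n \<and> int m dvd x + int n - y"
proof -
  obtain k where k: "k \<in> {0..<int m}" "x = position m n w t k" using x by blast
  \<comment> \<open>The cyclic predecessor of \<open>k\<close>.\<close>
  define l where "l = (if k = 0 then int m - 1 else k - 1)"
  have l: "l \<in> {0..<int m}" using k(1) by (auto simp: l_def)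
  have lt: "{j. j < n \<and> w j < int m} = {j. j < n}" "{j. j < n \<and> w j < 0} = {}"
    using w by force+
  have "position m n w t l \<le> position m n w n l" by (rule position_mono[OF t])
  also have "\<dots> = position m n w 0 (l + 1) + int n" by (rule position_end)
  \<comment> \<open>For \<open>k = 0\<close> this compares index \<open>m\<close> with index
    \<open>0\<close>; both positions are \<open>0\<close>.\<close>
  also have "position m n w 0 (l + 1) = position m n w 0 k"
    by (simp add: l_def position_def lt)
  also have "\<dots> + int n \<le> x + int n" unfolding k(2) using position_mono[of 0 t] by simp
  finally have "position m n w t l \<le> x + int n" .
  moreover have "int m dvd x + int n - position m n w t l"
  proof -
    have "[x + int n = - (int n * k) + int n] (mod int m)"
      unfolding k(2) by (intro cong_add position_cong cong_refl)
    also have "[- (int n * k) + int n = - (int n * l)] (mod int m)"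
      by (simp add: l_def cong_iff_dvd_diff algebra_simps)
    also have "[- (int n * l) = position m n w t l] (mod int m)"
      using position_cong by (rule cong_sym)
    finally show ?thesis by (simp add: cong_iff_dvd_diff)
  qed
  ultimately show ?thesis using l by blast
qed

text \<open>The position formula recovers a tuple from its word. Conversely a parking word yields a
  circuit, and its parking inequalities say that the initial levels are nonnegative.\<close>

lemma bij_betw_A_word:
  assumes m: "0 < m" and co: "coprime m n" and a: "[a * int n = -1] (mod int m)"
  shows "bij_betw (A_word m a) (parking_tuples m n) (parking_words m n)"
  unfolding bij_betw_def
proof
  have pos: "t \<le> n \<Longrightarrow> min_levels m n (Fs ! t) = position m n ((!) (A_word m a (Fs, ps))) t ` {0..<int m}"
    "t < n \<Longrightarrow> ps ! t = position m n ((!) (A_word m a (Fs, ps))) t (A_word m a (Fs, ps) ! t)"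
    "k \<le> m \<Longrightarrow> 0 \<le> position m n ((!) (A_word m a (Fs, ps))) 0 (int k)"
    if "(Fs, ps) \<in> parking_tuples m n" for Fs ps t k
  proof -
    have c: "circuit m n (\<lambda>t. min_levels m n (Fs ! t)) ((!) ps)" and len: "length ps = n"
      and 0: "0 \<in> min_levels m n (Fs ! 0)" "\<forall>x\<in>min_levels m n (Fs ! 0). 0 \<le> x"
      using that parking_tuples_iff[OF m co] by blast+
    have w: "A_word m a (Fs, ps) ! t = (a * ps ! t) mod int m" if "t < n" for t
      using that len by (simp add: A_word_def)
    note pos = circuit_position[where w = "(!) (A_word m a (Fs, ps))", OF c m a 0(1)]
    show "t \<le> n \<Longrightarrow> min_levels m n (Fs ! t) = position m n ((!) (A_word m a (Fs, ps))) t ` {0..<int m}"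
      "t < n \<Longrightarrow> ps ! t = position m n ((!) (A_word m a (Fs, ps))) t (A_word m a (Fs, ps) ! t)"
      using pos(1,2) w by blast+
    show "k \<le> m \<Longrightarrow> 0 \<le> position m n ((!) (A_word m a (Fs, ps))) 0 (int k)"
      using pos(3) w 0(2) by blast
  qed
  show "inj_on (A_word m a) (parking_tuples m n)"
  proof (rule inj_onI, clarify)
    fix Fs ps Gs qs
    assume p: "(Fs, ps) \<in> parking_tuples m n" and q: "(Gs, qs) \<in> parking_tuples m n"
      and eq: "A_word m a (Fs, ps) = A_word m a (Gs, qs)"
    have "(Fs, ps) = (Gs, qs)"
      by (rule parking_tuple_eqI[OF m p q]) (simp_all only: pos[OF p] pos[OF q] eq)
    then show "Fs = Gs \<and> ps = qs" by simp
  qed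
  show "A_word m a ` parking_tuples m n = parking_words m n"
  proof (intro equalityI subsetI)
    fix w assume "w \<in> A_word m a ` parking_tuples m n"
    then obtain Fs ps where q: "(Fs, ps) \<in> parking_tuples m n" and w: "w = A_word m a (Fs, ps)"
      by auto
    have len: "length ps = n" using q by (simp add: parking_tuples_def filter_tuple_def)
    \<comment> \<open>The inequality for \<open>i\<close> is the nonnegativity of the initial
      position of index \<open>i\<close>.\<close>
    have "i * n \<le> m * card {j. j < n \<and> w ! j < int i}" if "i \<le> m" for i
    proof -
      have "int (i * n) \<le> int (m * card {j. j < n \<and> w ! j < int i})"
        using pos(3)[OF q that] unfolding w by (simp add: position_def algebra_simps)
      then show ?thesis by (simp only: of_nat_le_iff)
    qed
    then show "w \<in> parking_words m n"
      using len m by (auto simp: parking_words_def w A_word_def)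
  next
    fix w assume wP: "w \<in> parking_words m n"
    then have len: "length w = n" and bd: "\<And>i. i \<le> m \<Longrightarrow> i * n \<le> m * card {j. j < n \<and> w ! j < int i}"
      and w: "\<And>t. t < n \<Longrightarrow> w ! t \<in> {0..<int m}"
      unfolding parking_words_def using nth_mem by blast+
    define M where "M t = position m n ((!) w) t ` {0..<int m}" for t
    define p where "p t = position m n ((!) w) t (w ! t)" for t
    have c: "circuit m n M p"
      using position_circuit[where w = "(!) w", OF m a w] by (simp add: M_def[abs_def] p_def[abs_def])
    \<comment> \<open>\<open>position_closed\<close> is the closure property that makes a residue
      system the minimal levels of a filter.\<close>
    have "\<exists>F. mn_filter m n F \<and> min_levels m n F = M t" if "t \<le> n" for t
      using mn_filter_of_residue_system[OF circuit_residue_system[OF c that] m co]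
        position_closed[where w = "(!) w", OF m w that] unfolding M_def by metis
    then obtain G where G: "\<And>t. t \<le> n \<Longrightarrow> mn_filter m n (G t) \<and> min_levels m n (G t) = M t"
      by metis
    define Fs where "Fs = map G [0..<n + 1]"
    define ps where "ps = map p [0..<n]"
    have Fs: "min_levels m n (Fs ! t) = M t" if "t \<le> n" for t
      using G[OF that] that by (simp add: Fs_def del: upt_Suc)
    have ps: "ps ! t = p t" if "t < n" for t using that by (simp add: ps_def)
    have "circuit m n (\<lambda>t. min_levels m n (Fs ! t)) ((!) ps)"
      using c by (simp add: circuit_def Fs ps)
    moreover have "0 \<in> M 0"
    proof -
      have none: "{j. j < n \<and> w ! j < 0} = {}" using w by force
      have "position m n ((!) w) 0 0 = 0" by (simp add: position_def none)
      then show ?thesis unfolding M_def using m by force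
    qed
    moreover have "\<forall>x\<in>M 0. 0 \<le> x"
    proof
      fix x assume "x \<in> M 0"
      then obtain k where "k \<in> {0..<int m}" "x = position m n ((!) w) 0 k" by (auto simp: M_def)
      moreover define i where "i = nat k"
      ultimately have "i \<le> m" and x: "x = position m n ((!) w) 0 (int i)" by auto
      then have "int (i * n) \<le> int (m * card {j. j < n \<and> w ! j < int i})"
        using bd by (simp only: of_nat_le_iff)
      then show "0 \<le> x" unfolding x by (simp add: position_def algebra_simps)
    qed
    moreover have "\<forall>F\<in>set Fs. mn_filter m n F" using G by (auto simp: Fs_def)
    ultimately have "(Fs, ps) \<in> parking_tuples m n"
      unfolding parking_tuples_iff[OF m co] using Fs[of 0] by (simp add: Fs_def ps_def del: upt_Suc)
    moreover have "A_word m a (Fs, ps) = w"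
    proof (rule nth_equalityI)
      fix t assume "t < length (A_word m a (Fs, ps))"
      then have t: "t < n" by (simp add: A_word_def ps_def)
      have "[a * p t = a * - (int n * w ! t)] (mod int m)"
        unfolding p_def using position_cong by (rule cong_scalar_left)
      then have "[a * p t = w ! t] (mod int m)"
        using cong_neg_mult(2)[OF a] by (meson cong_trans)
      then show "A_word m a (Fs, ps) ! t = w ! t"
        using w[OF t] t by (simp add: A_word_def ps_def cong_def)
    qed (simp add: A_word_def ps_def len)
    ultimately show "w \<in> A_word m a ` parking_tuples m n" by force
  qed
qed

text \<open>Injectivity is the rigidity of matchings, and the rank bound puts the image inside the
  parking words. By the bijection \<open>A_word\<close> there are as many parking words as tuples,
  so the image is everything.\<close>

lemma bij_betw_B_word:
  assumes m: "0 < m" and co: "coprime m n" and a: "[a * int n = -1] (mod int m)"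
  shows "bij_betw (B_word m n) (parking_tuples m n) (parking_words m n)"
proof -
  have rank: "B_word m n (Fs, ps) ! t = int (rank (min_levels m n (Fs ! t)) (ps ! t))"
    if "t < n" for Fs ps t
    using that by (simp add: B_word_def rank_def)
  have inj: "inj_on (B_word m n) (parking_tuples m n)"
  proof (rule inj_onI, clarify)
    fix Fs ps Gs qs
    assume p: "(Fs, ps) \<in> parking_tuples m n" and q: "(Gs, qs) \<in> parking_tuples m n"
      and eq: "B_word m n (Fs, ps) = B_word m n (Gs, qs)"
    have c: "circuit m n (\<lambda>t. min_levels m n (Fs ! t)) ((!) ps)"
      and c0: "0 \<in> min_levels m n (Fs ! 0)" "\<forall>x\<in>min_levels m n (Fs ! 0). 0 \<le> x"
      using p parking_tuples_iff[OF m co] by blast+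
    have d: "circuit m n (\<lambda>t. min_levels m n (Gs ! t)) ((!) qs)"
      and d0: "0 \<in> min_levels m n (Gs ! 0)" "\<forall>x\<in>min_levels m n (Gs ! 0). 0 \<le> x"
      using q parking_tuples_iff[OF m co] by blast+
    have "\<forall>t<n. rank (min_levels m n (Fs ! t)) (ps ! t) = rank (min_levels m n (Gs ! t)) (qs ! t)"
      using rank eq by (metis of_nat_eq_iff)
    note inj = circuit_rank_inj[OF c d m co this c0(1) _ d0(1)]
    have "(Fs, ps) = (Gs, qs)"
      by (rule parking_tuple_eqI[OF m p q]) (use inj c0(2) d0(2) in blast)+
    then show "Fs = Gs \<and> ps = qs" by simp
  qed
  have sub: "B_word m n ` parking_tuples m n \<subseteq> parking_words m n"
  proof clarify
    fix Fs ps assume p: "(Fs, ps) \<in> parking_tuples m n"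
    then have c: "circuit m n (\<lambda>t. min_levels m n (Fs ! t)) ((!) ps)"
      using parking_tuples_iff[OF m co] by blast
    have len: "length (B_word m n (Fs, ps)) = n" by (simp add: B_word_def)
    have "B_word m n (Fs, ps) ! t \<in> {0..<int m}" if t: "t < n" for t
    proof -
      let ?M = "min_levels m n (Fs ! t)"
      have M: "finite ?M" "card ?M = m"
        using finite_residue_system card_residue_system circuit_residue_system[OF c] t m
        by (metis less_imp_le)+
      have "rank ?M (ps ! t) < m"
        using bij_betwE[OF bij_betw_rank[OF M(1)]] circuit_mem[OF c t] M(2) by auto
      then show ?thesis by (simp add: rank[OF t])
    qed
    then have "set (B_word m n (Fs, ps)) \<subseteq> {0..<int m}"
      using len by (metis in_set_conv_nth subsetI)
    moreover have "i * n \<le> m * card {j. j < n \<and> B_word m n (Fs, ps) ! j < int i}" if "i \<le> m" for i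
      using circuit_rank_bound[OF c m that] by (simp add: rank cong: conj_cong)
    ultimately show "B_word m n (Fs, ps) \<in> parking_words m n"
      using len by (simp add: parking_words_def)
  qed
  have "card (B_word m n ` parking_tuples m n) = card (parking_words m n)"
    using card_image[OF inj] bij_betw_same_card[OF bij_betw_A_word[OF m co a]] by simp
  then have "B_word m n ` parking_tuples m n = parking_words m n"
    using card_subset_eq[OF finite_parking_words sub] by blast
  with inj show ?thesis by (simp add: bij_betw_def)
qed

theorem theorem1p3:
  fixes m n :: nat and a :: int
  assumes "0 < m" and "0 < n" and "coprime m n"
    and "[a * int n = -1] (mod int m)"
  shows "(\<Sum>p\<in>parking_tuples m n. (fls_X_intpow (area m n a p) :: int fls)) =
         (\<Sum>p\<in>parking_tuples m n. fls_X_intpow (dinv m n p))"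
proof -
  \<comment> \<open>Both statistics are the same function of the respective word, so each sum equals
    the one over all parking words.\<close>
  let ?f = "\<lambda>w. fls_X_intpow ((int n - 1) * (int m - 1) div 2 - sum_list w) :: int fls"
  have "(\<Sum>p\<in>parking_tuples m n. ?f (A_word m a p)) = sum ?f (parking_words m n)"
    by (rule sum.reindex_bij_betw[OF bij_betw_A_word]) (use assms in auto)
  also have "\<dots> = (\<Sum>p\<in>parking_tuples m n. ?f (B_word m n p))"
    by (rule sum.reindex_bij_betw[OF bij_betw_B_word, symmetric]) (use assms in auto)
  finally show ?thesis by (simp add: area_def dinv_def)
qed

end
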